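(* Let $\mathcal{F}$ be a set of probability densities (with respect to Lebesgue measure) on $[0,1]$. The parameter $(\theta,f)$ in the mixture model $g=\theta+(1-\theta)f$ is identifiable on $(0,1)\times\mathcal{F}$ if and only if for all $f\in\mathcal{F}$ and for all $c\in(0,1)$ we have $c+(1-c)f\notin\mathcal{F}$.
   Context: The observations have density $g(x)=\theta+(1-\theta)f(x)$ on $[0,1]$. The parameter $(\theta,f)$ is identifiable on $(0,1)\times\mathcal{F}$ if the map $(\theta,f)\mapsto \theta+(1-\theta)f$ is injective on $(0,1)\times\mathcal{F}$: whenever $(\theta_1,f_1),(\theta_2,f_2)\in(0,1)\times\mathcal{F}$ satisfy $\theta_1+(1-\theta_1)f_1=\theta_2+(1-\theta_2)f_2$, then $(\theta_1,f_1)=(\theta_2,f_2)$. Densities are identified when they are equal almost everywhere. *)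

theory Defs
  imports "HOL-Analysis.Analysis"
begin

abbreviation leb01 :: "real measure" where
  "leb01 \<equiv> lebesgue_on {0..1}"

definition prob_density :: "(real \<Rightarrow> real) \<Rightarrow> bool" where
  "prob_density f \<longleftrightarrow>
     integrable leb01 f \<and> (AE x in leb01. 0 \<le> f x) \<and> integral\<^sup>L leb01 f = 1"

text \<open>Densities are represented by functions and identified when they agree almost
  everywhere on the unit interval; values outside the interval are irrelevant. Accordingly,
  both equality of densities and membership of a density in a set of densities are taken up
  to almost everywhere equality. No closure of the representing set of functions under
  almost everywhere equality is required.\<close>

definition ae_eq :: "(real \<Rightarrow> real) \<Rightarrow> (real \<Rightarrow> real) \<Rightarrow> bool" where
  "ae_eq f g \<longleftrightarrow> (AE x in leb01. f x = g x)"

definition ae_mem :: "(real \<Rightarrow> real) \<Rightarrow> (real \<Rightarrow> real) set \<Rightarrow> bool" where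
  "ae_mem g F \<longleftrightarrow> (\<exists>f\<in>F. ae_eq g f)"

definition mixture :: "real \<Rightarrow> (real \<Rightarrow> real) \<Rightarrow> real \<Rightarrow> real" where
  "mixture \<theta> f = (\<lambda>x. \<theta> + (1 - \<theta>) * f x)"

definition identifiable :: "(real \<Rightarrow> real) set \<Rightarrow> bool" where
  "identifiable F \<longleftrightarrow>
     (\<forall>\<theta>\<^sub>1\<in>{0<..<1}. \<forall>f\<^sub>1\<in>F. \<forall>\<theta>\<^sub>2\<in>{0<..<1}. \<forall>f\<^sub>2\<in>F.
        ae_eq (mixture \<theta>\<^sub>1 f\<^sub>1) (mixture \<theta>\<^sub>2 f\<^sub>2) \<longrightarrow> \<theta>\<^sub>1 = \<theta>\<^sub>2 \<and> ae_eq f\<^sub>1 f\<^sub>2)"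

end

theory Submission imports Defs begin

text \<open>Mixing with the uniform density composes (\<open>mixture_mixture\<close>), and for a
  fixed weight below 1 it can be cancelled (\<open>ae_eq_mixture_iff\<close>). If
  \<open>mixture c f\<close> agrees a.e. with some \<open>h\<close> in \<open>F\<close>, mixing both
  with one more weight gives a single density with two different weights, so identifiability fails.
  Conversely, two representations with weights \<open>a < b\<close> share the factor
  \<open>mixture a\<close>; cancelling it exhibits a member of \<open>F\<close> as a proper mixture
  of another (\<open>ae_eq_mixture_less\<close>). So the weights agree, and cancelling gives
  \<open>f = g\<close> a.e.\<close>

lemma mixture_mixture:
  "mixture \<theta> (mixture c f) = mixture (\<theta> + (1 - \<theta>) * c) f"
  by (simp add: mixture_def fun_eq_iff algebra_simps)

lemma mixture_eq_cancel:
  assumes "\<theta> < 1"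
  shows "mixture \<theta> f x = mixture \<theta> g x \<longleftrightarrow> f x = g x"
  using assms by (simp add: mixture_def)

lemma ae_eq_mixture_iff:
  assumes "\<theta> < 1"
  shows "ae_eq (mixture \<theta> f) (mixture \<theta> g) \<longleftrightarrow> ae_eq f g"
  by (simp add: ae_eq_def mixture_eq_cancel[OF assms])

lemma ae_eq_sym: "ae_eq f g \<Longrightarrow> ae_eq g f"
  by (simp add: ae_eq_def eq_commute)

text \<open>Adding weight \<open>a\<close> and then \<open>c\<close> leaves the factor
  \<open>(1 - a) * (1 - c)\<close> on \<open>g\<close>. Equating it with \<open>1 - b\<close>
  determines \<open>c\<close>, and \<open>a < b < 1\<close> puts it strictly between 0 and
  1.\<close>

lemma ae_eq_mixture_less:
  assumes "a < b" "b < 1" "ae_eq (mixture a f) (mixture b g)"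
  obtains c where "c \<in> {0<..<1}" "ae_eq f (mixture c g)"
proof
  define c where "c = (b - a) / (1 - a)"
  show "c \<in> {0<..<1}"
    using assms(1,2) by (simp add: c_def)
  have "b = a + (1 - a) * c"
    using assms(1,2) by (simp add: c_def)
  then have "mixture b g = mixture a (mixture c g)"
    by (simp only: mixture_mixture)
  with assms show "ae_eq f (mixture c g)"
    by (simp add: ae_eq_mixture_iff)
qed

theorem proposition1:
  fixes F :: "(real \<Rightarrow> real) set"
  assumes "\<And>f. f \<in> F \<Longrightarrow> prob_density f"
  shows "identifiable F \<longleftrightarrow>
    (\<forall>f\<in>F. \<forall>c\<in>{0<..<1}. \<not> ae_mem (\<lambda>x. c + (1 - c) * f x) F)"
proof -
  have "identifiable F \<longleftrightarrow> (\<forall>f\<in>F. \<forall>c\<in>{0<..<1}. \<not> ae_mem (mixture c f) F)"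
  proof
    assume ident: "identifiable F"
    show "\<forall>f\<in>F. \<forall>c\<in>{0<..<1}. \<not> ae_mem (mixture c f) F"
    proof (intro ballI notI)
      fix f and c :: real
      assume f: "f \<in> F" and c: "c \<in> {0<..<1}" and "ae_mem (mixture c f) F"
      then obtain h where h: "h \<in> F" and "ae_eq (mixture c f) h"
        by (auto simp: ae_mem_def)
      \<comment> \<open>Any weight in (0,1) would serve in place of 1/2. The two sides become
        mixtures of members of \<open>F\<close> whose weights differ by \<open>c/2\<close>.\<close>
      then have "ae_eq (mixture (1/2) (mixture c f)) (mixture (1/2) h)"
        by (simp add: ae_eq_mixture_iff)
      then have "ae_eq (mixture (1/2 + c/2) f) (mixture (1/2) h)"
        by (simp add: mixture_mixture)
      moreover have "1/2 + c/2 \<in> {0<..<1}" "(1/2::real) \<in> {0<..<1}"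
        using c by auto
      ultimately have "1/2 + c/2 = 1/2"
        using ident f h unfolding identifiable_def by blast
      with c show False by simp
    qed
  next
    assume notin: "\<forall>f\<in>F. \<forall>c\<in>{0<..<1}. \<not> ae_mem (mixture c f) F"
    \<comment> \<open>The situation is symmetric in the two representations, so excluding one strict
      order, for arbitrary pairs, excludes both.\<close>
    have not_less: "\<not> a < b"
      if fg: "f \<in> F" "g \<in> F" and b: "b < 1" and eq: "ae_eq (mixture a f) (mixture b g)" for a b f g
    proof
      assume "a < b"
      then obtain c where "c \<in> {0<..<1}" "ae_eq f (mixture c g)"
        using b eq by (rule ae_eq_mixture_less)
      then show False
        using notin fg ae_eq_sym unfolding ae_mem_def by blast
    qed
    show "identifiable F"
      unfolding identifiable_def
    proof (intro ballI impI)
      fix a b :: real and f g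
      assume fg: "f \<in> F" "g \<in> F" and ab: "a \<in> {0<..<1}" "b \<in> {0<..<1}"
        and eq: "ae_eq (mixture a f) (mixture b g)"
      have "\<not> a < b" "\<not> b < a"
        using not_less[of f g b a] not_less[of g f a b] fg ab eq ae_eq_sym[OF eq] by auto
      then have "a = b" by simp
      with eq ab show "a = b \<and> ae_eq f g"
        by (simp add: ae_eq_mixture_iff)
    qed
  qed
  then show ?thesis
    by (simp only: mixture_def)
qed

end
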